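(* Let $p$ be an odd prime, let $m$ be any positive integer, and let $a\in\mathbb{F}_{p^m}^\times$. Then $\zeta_{x^{p^m}+ax}(\overline{\mathbb{F}}_p;t)$ is transcendental over $\mathbb{Q}(t)$.
   Context: Let $\overline{\mathbb{F}}_p$ be an algebraic closure of $\mathbb{F}_p$ and $\mathbb{F}_{p^m}\subset\overline{\mathbb{F}}_p$ its subfield with $p^m$ elements. For a polynomial $f\in\overline{\mathbb{F}}_p[x]$ of degree $d\geq 2$, regard $f$ as a self-map of $\mathbb{A}^1(\overline{\mathbb{F}}_p)=\overline{\mathbb{F}}_p$. Write $f^n$ for $f$ composed with itself $n$ times, and let $a_n=\#\{x\in\overline{\mathbb{F}}_p : f^n(x)=x\}$, the number of fixed points of $f^n$, counted without multiplicity (this is finite, with $a_n\leq d^n$). The Artin-Mazur zeta function of $f$ is the formal power series $$\zeta_f(\overline{\mathbb{F}}_p;t)=\exp\left(\sum_{n=1}^\infty a_n\frac{t^n}{n}\right)\in\mathbb{Q}[[t]].$$ Here $\zeta_{x^{p^m}+ax}$ denotes the zeta function of the map $x\mapsto x^{p^m}+ax$. Transcendence over $\mathbb{Q}(t)$ is understood inside the field of formal Laurent series $\mathbb{Q}((t))$, which contains both $\mathbb{Q}(t)$ and $\mathbb{Q}[[t]]$. *)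

theory Defs
  imports
    "HOL-Computational_Algebra.Computational_Algebra"
    "HOL-Algebra.Algebraic_Closure_Type"
begin

(* The n = 0 value is never used: the zeta function starts at n = 1.  If the
   set is infinite (impossible for degree at least 2 and n \<ge> 1), card gives 0. *)
definition num_fixpoints :: "'k::field poly \<Rightarrow> nat \<Rightarrow> nat" where
  "num_fixpoints f n = card {x. (poly f ^^ n) x = x}"

definition artin_mazur_zeta :: "'k::field poly \<Rightarrow> rat fps" where
  "artin_mazur_zeta f =
     fps_exp 1 oo Abs_fps (\<lambda>n. if n = 0 then 0 else of_nat (num_fixpoints f n) / of_nat n)"

(* The subfield Q(t) of Q((t)). *)
definition rational_fls :: "rat fls set" where
  "rational_fls =
     {fps_to_fls (fps_of_poly P) / fps_to_fls (fps_of_poly Q) | P Q. Q \<noteq> 0}"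

end

theory Submission
  imports Defs "HOL-Complex_Analysis.Complex_Analysis"
begin

text \<open>
  Write $q = p^m$ and let $\varphi(x) = x^q$.  Since $a^q = a$, the map $f$ is the additive operator
  $\varphi + a$, so the fixed points of $f^n$ form the kernel of $(T + a)^n - 1$ evaluated at
  $T = \varphi$.  Such a kernel has $q^{n - s}$ elements, where $s$ is the order of vanishing at
  $T = 0$; here $s = 0$ if $a^n \neq 1$, and $s$ is the largest power of $p$ dividing $n$ otherwise.

  Consequently the complex function $\zeta_f$ is holomorphic on $|t| < 1/q$, and its radial limit is $0$
  at $\omega/q$ for every root of unity $\omega$ of order $p^j$, $j \geq 1$.  The constant coefficient of
  a polynomial relation for $\zeta_f$ would vanish at all these points, hence vanish identically;
  dividing the relation by a power of $\zeta_f$ excludes this.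
\<close>

subsection \<open>Fields\<close>

text \<open>Bridge from HOL-Algebra, where a polynomial is a coefficient list with the leading
  coefficient first, to the polynomial type; hence the reversed list \<open>P\<close>.\<close>

lemma algebraically_closed_imp_poly_root:
  fixes f :: "'k::field poly"
  assumes "algebraically_closed (ring_of_type_algebra :: 'k ring)" "degree f > 0"
  shows "\<exists>x. poly f x = 0"
proof -
  define L where "L = (ring_of_type_algebra :: 'k ring)"
  interpret algebraically_closed L unfolding L_def by (rule assms)
  have ops: "carrier L = UNIV" "\<zero>\<^bsub>L\<^esub> = 0" "\<one>\<^bsub>L\<^esub> = 1"
    "x \<oplus>\<^bsub>L\<^esub> y = x + y" "x \<otimes>\<^bsub>L\<^esub> y = x * y" for x y
    by (simp_all add: L_def ring_of_type_algebra_def)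
  have pow: "x [^]\<^bsub>L\<^esub> n = x ^ n" for x and n :: nat
    by (induction n) (simp_all add: ops mult.commute)
  define P where "P = rev (Polynomial.coeffs f)"
  have deg: "Polynomials.degree P = Polynomial.degree f"
    by (auto simp: P_def degree_eq_length_coeffs)
  have P: "P \<in> carrier (poly_ring L)"
    by (auto simp: univ_poly_def polynomial_def P_def hd_rev last_coeffs_eq_coeff_degree ops)
  hence "splitted P"
    by (rule roots_over_carrier)
  hence "roots P \<noteq> {#}"
    unfolding splitted_def using deg assms(2) by auto
  then obtain x where "x \<in># roots P"
    by blast
  hence "is_root P x"
    using roots_mem_iff_is_root[OF P] by auto
  moreover have "eval xs x = poly (Poly (rev xs)) x" for xs
    by (induction xs) (auto simp: ops pow Poly_append poly_monom mult.commute)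
  ultimately have "poly f x = 0"
    by (simp add: is_root_def P_def ops)
  thus ?thesis ..
qed

text \<open>Roots are split off one at a time. The condition on the derivative makes each root
  simple, so the root removed is not a root of the quotient, and the quotient inherits the
  condition.\<close>

lemma card_roots_eq_degree:
  fixes f :: "'k::field poly"
  assumes "\<And>g :: 'k poly. degree g > 0 \<Longrightarrow> \<exists>x. poly g x = 0"
    and "f \<noteq> 0" "\<And>x. poly f x = 0 \<Longrightarrow> poly (pderiv f) x \<noteq> 0"
  shows "card {x. poly f x = 0} = degree f"
  using assms(2,3)
proof (induction "degree f" arbitrary: f)
  case 0
  then obtain c where "f = [:c:]"
    by (metis degree_eq_zeroE)
  with 0 show ?case by auto
next
  case (Suc n)
  from Suc.hyps(2) assms(1) obtain r where r: "poly f r = 0"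
    by (metis zero_less_Suc)
  then obtain g where f: "f = [:-r, 1:] * g"
    by (metis poly_eq_0_iff_dvd dvdE)
  have g: "g \<noteq> 0" using Suc.prems f by auto
  have "degree f = 1 + degree g"
    unfolding f using g by (subst degree_mult_eq) auto
  with Suc.hyps have n: "n = degree g" by simp
  have d: "pderiv f = g + [:-r, 1:] * pderiv g"
    unfolding f by (subst pderiv_mult) (simp add: pderiv_pCons)
  have "poly g r \<noteq> 0"
    using Suc.prems(2)[OF r] by (simp add: d)
  moreover have "card {x. poly g x = 0} = n"
    unfolding n
  proof (rule Suc.hyps(1)[OF n g])
    fix x assume "poly g x = 0"
    with Suc.prems(2)[of x] show "poly (pderiv g) x \<noteq> 0"
      unfolding d by (auto simp: f)
  qed
  moreover have "{x. poly f x = 0} = insert r {x. poly g x = 0}"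
    by (auto simp: f)
  moreover have "finite {x. poly g x = 0}"
    using g by (rule poly_roots_finite)
  ultimately show ?case
    using Suc.hyps(2) by simp
qed

section \<open>Finite subfields: characteristic and multiplicative group\<close>

lemma subfield_of_type_closed:
  fixes F :: "'k::field set"
  assumes "subfield F (ring_of_type_algebra :: 'k ring)"
  shows "1 \<in> F" "0 \<in> F" "x \<in> F \<Longrightarrow> y \<in> F \<Longrightarrow> x + y \<in> F" "x \<in> F \<Longrightarrow> y \<in> F \<Longrightarrow> x * y \<in> F"
proof -
  have s: "subring F (ring_of_type_algebra :: 'k ring)"
    using assms by (rule subfieldE)
  show "1 \<in> F" "0 \<in> F" "x \<in> F \<Longrightarrow> y \<in> F \<Longrightarrow> x + y \<in> F" "x \<in> F \<Longrightarrow> y \<in> F \<Longrightarrow> x * y \<in> F"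
    using subringE[OF s] by (simp_all add: ring_of_type_algebra_def)
qed

text \<open>Translation by 1 permutes \<open>F\<close>, yet it raises the sum of the elements by
  \<open>card F\<close>. This later determines the characteristic.\<close>

lemma of_nat_card_eq_0:
  fixes F :: "'k::field set"
  assumes "finite F" "F \<noteq> {}" "\<And>x. x \<in> F \<Longrightarrow> x + 1 \<in> F"
  shows "of_nat (card F) = (0 :: 'k)"
proof -
  have "inj_on (\<lambda>x::'k. x + 1) F" by (auto simp: inj_on_def)
  moreover have "(\<lambda>x. x + 1) ` F \<subseteq> F"
    using assms(3) by blast
  ultimately have "(\<lambda>x. x + 1) ` F = F"
    using assms(1) by (intro card_subset_eq) (simp_all only: card_image)
  hence "\<Sum>F = (\<Sum>x\<in>F. x + 1)"
    using sum.reindex[OF \<open>inj_on (\<lambda>x::'k. x + 1) F\<close>, of id]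
    by (simp only: comp_def id_def)
  also have "\<dots> = \<Sum>F + of_nat (card F)"
    by (simp add: sum.distrib)
  finally show ?thesis by simp
qed

text \<open>Multiplication by \<open>a\<close> permutes the nonzero elements of \<open>F\<close>;
  comparing their product before and after leaves a power of \<open>a\<close> equal to 1.\<close>

lemma power_card_minus_1_eq_1:
  fixes F :: "'k::field set"
  assumes "finite F" "0 \<in> F" "a \<in> F" "a \<noteq> 0" "\<And>x. x \<in> F \<Longrightarrow> a * x \<in> F"
  shows "a ^ (card F - 1) = 1"
proof -
  define G where "G = F - {0}"
  have inj: "inj_on (\<lambda>x. a * x) G" using assms(4) by (auto simp: inj_on_def)
  moreover have "(\<lambda>x. a * x) ` G \<subseteq> G"
    using assms(4,5) by (auto simp: G_def)
  ultimately have "(\<lambda>x. a * x) ` G = G"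
    using assms(1) by (intro card_subset_eq) (simp_all only: card_image G_def finite_Diff)
  hence "\<Prod>G = (\<Prod>x\<in>G. a * x)"
    using prod.reindex[OF inj, of id] by (simp only: comp_def id_def)
  also have "\<dots> = a ^ card G * \<Prod>G"
    by (simp add: prod.distrib)
  finally have "\<Prod>G = a ^ card G * \<Prod>G" .
  moreover have "\<Prod>G \<noteq> 0"
    using assms(1) by (simp add: G_def)
  ultimately have "a ^ card G = 1"
    by (metis mult_cancel_right mult_1)
  thus ?thesis using assms(1,2) by (simp add: G_def)
qed

section \<open>Linearized polynomials: evaluation at x applies g, as a polynomial in the operator x
  -> x^q, to x\<close>

definition linearized :: "nat \<Rightarrow> 'k::field poly \<Rightarrow> 'k poly" where
  "linearized q g = (\<Sum>i\<le>degree g. monom (coeff g i) (q ^ i))"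

text \<open>The free bound \<open>N\<close> lets polynomials of different degrees be compared over
  one common range.\<close>

lemma poly_linearized:
  assumes "degree g \<le> N"
  shows "poly (linearized q g) x = (\<Sum>i\<le>N. coeff g i * x ^ (q ^ i))"
proof -
  have "(\<Sum>i\<le>degree g. coeff g i * x ^ (q ^ i)) = (\<Sum>i\<le>N. coeff g i * x ^ (q ^ i))"
    using assms by (intro sum.mono_neutral_left) (auto simp: coeff_eq_0)
  thus ?thesis by (simp add: linearized_def poly_sum poly_monom)
qed

lemma poly_linearized_diff:
  "poly (linearized q (g - h)) x = poly (linearized q g) x - poly (linearized q h) x"
proof -
  define N where "N = max (degree g) (degree h)"
  have "degree (g - h) \<le> N" "degree g \<le> N" "degree h \<le> N"
    by (auto simp: N_def degree_diff_le_max)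
  thus ?thesis by (simp add: poly_linearized sum_subtractf algebra_simps)
qed

lemma poly_linearized_add:
  "poly (linearized q (g + h)) x = poly (linearized q g) x + poly (linearized q h) x"
  using poly_linearized_diff[of q "g + h" h x] by simp

lemma poly_linearized_smult:
  "poly (linearized q (smult c g)) x = c * poly (linearized q g) x"
  using poly_linearized[OF order.refl, of q g] poly_linearized[OF degree_smult_le, of q c g]
  by (simp add: sum_distrib_left mult.assoc)

lemma poly_linearized_const: "poly (linearized q [:c:]) x = c * x"
  by (simp add: linearized_def poly_monom)

lemma poly_linearized_pCons_0:
  "poly (linearized q (pCons 0 g)) x = poly (linearized q g) (x ^ q)"
proof -
  have "degree (pCons 0 g) \<le> Suc (degree g)" by (simp add: degree_pCons_le)
  from poly_linearized[OF this] show ?thesis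
    by (simp add: sum.atMost_Suc_shift poly_linearized[OF order.refl] power_mult del: sum.atMost_Suc)
qed

text \<open>This isolates the inseparable part of an operator: a power of the variable only
  precomposes an iterate of x -> x^q, which is bijective in the application.\<close>

lemma poly_linearized_shift:
  "poly (linearized q ([:0, 1:] ^ s * g)) x = poly (linearized q g) (x ^ (q ^ s))"
  by (induction s arbitrary: x)
     (simp_all add: poly_linearized_pCons_0 mult.assoc power_mult del: power_Suc flip: power_Suc2,
      simp add: poly_linearized_pCons_0 power_mult)

lemma degree_linearized:
  assumes "g \<noteq> 0" "q \<ge> 2"
  shows "degree (linearized q g) = q ^ degree g"
proof (rule antisym)
  show "degree (linearized q g) \<le> q ^ degree g"
    unfolding linearized_def
  proof (intro degree_sum_le)
    fix i assume "i \<in> {..degree g}"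
    hence "q ^ i \<le> q ^ degree g"
      using assms by (intro power_increasing) auto
    thus "degree (monom (coeff g i) (q ^ i)) \<le> q ^ degree g"
      using degree_monom_le[of "coeff g i" "q ^ i"] by linarith
  qed auto
  \<comment> \<open>As \<open>q\<close> is at least 2, the exponents q^i are distinct, so only the
    top term contributes to this coefficient.\<close>
  have "coeff (linearized q g) (q ^ degree g) =
      (\<Sum>i\<le>degree g. if i = degree g then coeff g i else 0)"
    using assms unfolding linearized_def coeff_sum by (intro sum.cong) auto
  also have "\<dots> = lead_coeff g" by simp
  finally show "q ^ degree g \<le> degree (linearized q g)"
    using assms by (intro le_degree) auto
qed

text \<open>The exponents q^i with i > 0 vanish in the field, so only the linear term survives.
  Hence all roots are simple as soon as the constant coefficient of \<open>g\<close> is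
  nonzero.\<close>

lemma pderiv_linearized:
  fixes g :: "'k::field poly"
  assumes "of_nat q = (0 :: 'k)"
  shows "pderiv (linearized q g) = [:coeff g 0:]"
proof -
  have "pderiv (linearized q g) = (\<Sum>i\<le>degree g. if i = 0 then [:coeff g 0:] else 0)"
    unfolding linearized_def higher_pderiv_sum[where n = 1, simplified] pderiv_monom
    using assms by (intro sum.cong) (auto simp: monom_0 power_0_left)
  thus ?thesis by simp
qed

subsection \<open>Transcendence over the rational functions\<close>

lemma rational_fls_subring: "subring rational_fls (ring_of_type_algebra :: rat fls ring)"
proof -
  define R where "R = (ring_of_type_algebra :: rat fls ring)"
  interpret ring R unfolding R_def by rule
  have ops: "carrier R = UNIV" "\<zero>\<^bsub>R\<^esub> = 0" "\<one>\<^bsub>R\<^esub> = 1"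
    "x \<oplus>\<^bsub>R\<^esub> y = x + y" "x \<otimes>\<^bsub>R\<^esub> y = x * y" for x y
    by (simp_all add: R_def ring_of_type_algebra_def)
  have minus: "\<ominus>\<^bsub>R\<^esub> x = - x" for x
    by (rule minus_equality) (simp_all add: ops)
  show ?thesis unfolding R_def[symmetric]
  proof (rule subringI, goal_cases)
    case 2
    show ?case
      unfolding rational_fls_def ops by (rule CollectI, rule exI[of _ 1], rule exI[of _ 1]) simp
  next
    case (3 x)
    then obtain P Q where "x = fps_to_fls (fps_of_poly P) / fps_to_fls (fps_of_poly Q)" "Q \<noteq> 0"
      by (auto simp: rational_fls_def)
    thus ?case
      unfolding rational_fls_def minus
      by (intro CollectI exI[of _ "-P"] exI[of _ Q]) (simp add: fps_of_poly_uminus)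
  next
    case (4 x y)
    then obtain P Q P' Q' where "x = fps_to_fls (fps_of_poly P) / fps_to_fls (fps_of_poly Q)" "Q \<noteq> 0"
        "y = fps_to_fls (fps_of_poly P') / fps_to_fls (fps_of_poly Q')" "Q' \<noteq> 0"
      by (auto simp: rational_fls_def)
    thus ?case
      unfolding rational_fls_def ops
      by (intro CollectI exI[of _ "P * P'"] exI[of _ "Q * Q'"])
         (simp add: fps_of_poly_mult fls_times_fps_to_fls)
  next
    case (5 x y)
    then obtain P Q P' Q' where "x = fps_to_fls (fps_of_poly P) / fps_to_fls (fps_of_poly Q)" "Q \<noteq> 0"
        "y = fps_to_fls (fps_of_poly P') / fps_to_fls (fps_of_poly Q')" "Q' \<noteq> 0"
      by (auto simp: rational_fls_def)
    thus ?case
      unfolding rational_fls_def ops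
      by (intro CollectI exI[of _ "P * Q' + P' * Q"] exI[of _ "Q * Q'"])
         (simp add: fps_of_poly_mult fps_of_poly_add fls_times_fps_to_fls field_simps)
  qed (simp add: ops)
qed

text \<open>Multiplication by a common denominator \<open>Q\<close> moves the coefficients into
  Q[t]. Since \<open>cs\<close> starts with the leading coefficient while \<open>b\<close> is
  indexed by exponent, the head of \<open>cs\<close> belongs to index \<open>length cs - 1\<close>;
  the last conjunct keeps the relation nontrivial.\<close>

lemma clear_denominators:
  assumes "set cs \<subseteq> rational_fls"
  shows "\<exists>Q b. Q \<noteq> 0 \<and>
    fps_to_fls (fps_of_poly Q) * ring.eval (ring_of_type_algebra :: rat fls ring) cs x =
      (\<Sum>i<length cs. fps_to_fls (fps_of_poly (b i)) * x ^ i) \<and>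
    (cs \<noteq> [] \<longrightarrow> hd cs \<noteq> 0 \<longrightarrow> b (length cs - 1) \<noteq> 0)"
  using assms
proof (induction cs)
  define R where "R = (ring_of_type_algebra :: rat fls ring)"
  interpret ring R unfolding R_def by rule
  have ops: "carrier R = UNIV" "\<zero>\<^bsub>R\<^esub> = 0" "\<one>\<^bsub>R\<^esub> = 1"
    "x \<oplus>\<^bsub>R\<^esub> y = x + y" "x \<otimes>\<^bsub>R\<^esub> y = x * y" for x y
    by (simp_all add: R_def ring_of_type_algebra_def)
  have pow: "x [^]\<^bsub>R\<^esub> n = x ^ n" for x and n :: nat
    by (induction n) (simp_all add: ops mult.commute)
  {
    case Nil
    show ?case unfolding R_def[symmetric] by (intro exI[of _ 1]) (simp add: ops)
  next
    case (Cons c cs)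
    from Cons obtain Q b where Qb: "Q \<noteq> 0"
      "fps_to_fls (fps_of_poly Q) * eval cs x = (\<Sum>i<length cs. fps_to_fls (fps_of_poly (b i)) * x ^ i)"
      by (auto simp: R_def)
    from Cons.prems obtain P Q' where c: "c = fps_to_fls (fps_of_poly P) / fps_to_fls (fps_of_poly Q')"
      and Q': "Q' \<noteq> 0"
      by (auto simp: rational_fls_def)
    \<comment> \<open>Multiplying by Q * Q' turns the new leading coefficient P / Q' into P * Q and
      scales the earlier numerators by Q'.\<close>
    define b' where "b' = (\<lambda>i. if i = length cs then P * Q else Q' * b i)"
    have "fps_to_fls (fps_of_poly (Q * Q')) * eval (c # cs) x =
      fps_to_fls (fps_of_poly (P * Q)) * x ^ length cs +
      fps_to_fls (fps_of_poly Q') * (fps_to_fls (fps_of_poly Q) * eval cs x)"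
      using Q' by (simp add: ops pow c fps_of_poly_mult fls_times_fps_to_fls field_simps)
    also have "\<dots> = (\<Sum>i<length (c # cs). fps_to_fls (fps_of_poly (b' i)) * x ^ i)"
      unfolding Qb(2)
      by (simp add: b'_def sum_distrib_left fps_of_poly_mult fls_times_fps_to_fls mult.assoc)
    finally show ?case
      using Qb(1) Q' c unfolding R_def[symmetric]
      by (intro exI[of _ "Q * Q'"] exI[of _ b']) (auto simp: b'_def)
  }
qed

text \<open>After clearing denominators, a relation can be divided by the power of \<open>Z\<close>
  at its lowest nonzero coefficient. So only relations with nonzero constant coefficient have to be
  excluded, and these live in the power series ring.\<close>

lemma transcendental_fps_to_flsI:
  fixes Z :: "rat fps"
  assumes "Z \<noteq> 0"
    and no_relation: "\<And>b N. b 0 \<noteq> 0 \<Longrightarrow> (\<Sum>i\<le>N. fps_of_poly (b i) * Z ^ i) \<noteq> 0"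
  shows "ring.transcendental (ring_of_type_algebra :: rat fls ring) rational_fls (fps_to_fls Z)"
proof -
  define R where "R = (ring_of_type_algebra :: rat fls ring)"
  interpret field R unfolding R_def by rule
  have ops: "carrier R = UNIV" "\<zero>\<^bsub>R\<^esub> = 0"
    by (simp_all add: R_def ring_of_type_algebra_def)
  have "cs = []" if cs: "cs \<in> carrier (rational_fls[X]\<^bsub>R\<^esub>)" "eval cs (fps_to_fls Z) = 0" for cs
  proof (rule ccontr)
    assume "cs \<noteq> []"
    with cs have "set cs \<subseteq> rational_fls" and hd: "hd cs \<noteq> 0"
      by (auto simp: univ_poly_def polynomial_def ops)
    from clear_denominators[OF this(1), of "fps_to_fls Z"] cs(2) obtain b where
      sum: "(\<Sum>i<length cs. fps_to_fls (fps_of_poly (b i)) * fps_to_fls Z ^ i) = 0" and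
      "b (length cs - 1) \<noteq> 0"
      using \<open>cs \<noteq> []\<close> hd unfolding R_def[symmetric] by force
    define j where "j = (LEAST i. b i \<noteq> 0)"
    have j: "b j \<noteq> 0" "j \<le> length cs - 1"
      unfolding j_def by (rule LeastI Least_le, fact)+
    have below: "b i = 0" if "i < j" for i
      using not_less_Least[of i "\<lambda>i. b i \<noteq> 0"] that by (auto simp: j_def)
    have sum': "(\<Sum>i<n. fps_to_fls (fps_of_poly (b i)) * fps_to_fls Z ^ i) =
      fps_to_fls (\<Sum>i<n. fps_of_poly (b i) * Z ^ i)" for n
      by (induction n) (simp_all add: fls_times_fps_to_fls fps_to_fls_power)
    have "0 = (\<Sum>i<length cs. fps_of_poly (b i) * Z ^ i)"
      using sum unfolding sum' by simp
    also have "\<dots> = (\<Sum>i=j..length cs - 1. fps_of_poly (b i) * Z ^ i)"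
      using \<open>cs \<noteq> []\<close> below
      by (intro sum.mono_neutral_right) (auto simp: not_le Suc_le_eq le_less_Suc_eq simp flip: less_Suc_eq_le)
    also have "\<dots> = (\<Sum>i\<le>length cs - 1 - j. fps_of_poly (b (i + j)) * Z ^ (i + j))"
      using j(2) by (intro sum.reindex_bij_witness[of _ "\<lambda>i. i + j" "\<lambda>i. i - j"]) auto
    also have "\<dots> = Z ^ j * (\<Sum>i\<le>length cs - 1 - j. fps_of_poly (b (i + j)) * Z ^ i)"
      by (simp add: sum_distrib_left power_add mult_ac)
    finally show False
      using no_relation[of "\<lambda>i. b (i + j)" "length cs - 1 - j"] j(1) assms(1) by simp
  qed
  hence "a_kernel (rational_fls[X]\<^bsub>R\<^esub>) R (\<lambda>p. eval p (fps_to_fls Z)) = {[]}"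
    unfolding a_kernel_def' by (auto simp: ops univ_poly_def polynomial_def)
  from trivial_ker_imp_transcendental[OF _ _ this] rational_fls_subring
  show ?thesis by (simp add: over_def ops flip: R_def)
qed

subsection \<open>Radial limits\<close>

definition complex_fps :: "rat fps \<Rightarrow> complex fps" where
  "complex_fps F = Abs_fps (\<lambda>n. of_rat (fps_nth F n))"

lemma complex_fps_nth [simp]: "fps_nth (complex_fps F) n = of_rat (fps_nth F n)"
  by (simp add: complex_fps_def)

lemma complex_fps_mult: "complex_fps (F * G) = complex_fps F * complex_fps G"
  by (rule fps_ext) (simp add: fps_mult_nth of_rat_sum of_rat_mult)

lemma complex_fps_power: "complex_fps (F ^ n) = complex_fps F ^ n"
proof (induction n)
  case 0
  show ?case by (rule fps_ext) simp
qed (simp add: complex_fps_mult)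

lemma complex_fps_sum: "complex_fps (\<Sum>i\<in>I. F i) = (\<Sum>i\<in>I. complex_fps (F i))"
  by (rule fps_ext) (simp add: fps_sum_nth of_rat_sum)

lemma complex_fps_compose: "complex_fps (F oo G) = complex_fps F oo complex_fps G"
  by (rule fps_ext) (simp add: fps_compose_nth of_rat_sum of_rat_mult flip: complex_fps_power)

lemma complex_fps_exp: "complex_fps (fps_exp 1) = fps_exp 1"
proof (rule fps_ext)
  fix n
  have "of_rat (fact n) = (fact n :: complex)"
    by (metis of_nat_fact of_rat_of_nat_eq)
  thus "fps_nth (complex_fps (fps_exp 1)) n = fps_nth (fps_exp 1) n"
    by (simp add: of_rat_divide)
qed

lemma complex_fps_of_poly: "complex_fps (fps_of_poly P) = fps_of_poly (map_poly of_rat P)"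
  by (rule fps_ext) (simp add: coeff_map_poly)

text \<open>A relation makes the holomorphic function \<open>G\<close> vanish on the disc. Along
  each path exp(L) tends to 0, so \<open>G\<close> tends to the value of \<open>b 0\<close> at the
  endpoint, and \<open>b 0\<close> would have infinitely many roots. The endpoints may lie on the
  boundary circle, which is why only limits from inside occur.\<close>

lemma no_relation_exp_fps:
  fixes L :: "rat fps" and b :: "nat \<Rightarrow> rat poly"
  assumes L0: "fps_nth L 0 = 0"
    and conv: "fps_conv_radius (complex_fps L) \<ge> ereal R" "R > 0"
    and S: "infinite S"
    and path: "\<And>w. w \<in> S \<Longrightarrow> \<exists>\<gamma>. (\<gamma> \<longlongrightarrow> w) (at_left (1::real)) \<and>
      eventually (\<lambda>r. norm (\<gamma> r) < R) (at_left 1) \<and>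
      filterlim (\<lambda>r. Re (eval_fps (complex_fps L) (\<gamma> r))) at_bot (at_left 1)"
    and b0: "b 0 \<noteq> 0"
  shows "(\<Sum>i\<le>N. fps_of_poly (b i) * (fps_exp 1 oo L) ^ i) \<noteq> 0"
proof
  assume zero: "(\<Sum>i\<le>N. fps_of_poly (b i) * (fps_exp 1 oo L) ^ i) = 0"
  define B :: "nat \<Rightarrow> complex poly" where "B i = map_poly of_rat (b i)" for i
  define f where "f z = exp (eval_fps (complex_fps L) z)" for z
  define G where "G z = (\<Sum>i\<le>N. poly (B i) z * f z ^ i)" for z
  have "eval_fps (complex_fps L) has_fps_expansion complex_fps L"
    using conv by (intro eval_fps_has_fps_expansion) (auto intro: less_le_trans[of _ "ereal R"])
  from has_fps_expansion_compose[OF has_fps_expansion_exp1 this]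
  have f: "f has_fps_expansion complex_fps (fps_exp 1 oo L)"
    by (simp add: f_def[abs_def] o_def complex_fps_compose complex_fps_exp L0)
  have poly: "poly P has_fps_expansion fps_of_poly P" for P :: "complex poly"
    using eval_fps_has_fps_expansion[of "fps_of_poly P"] by (simp add: eval_fps_of_poly[abs_def])
  have "G has_fps_expansion (\<Sum>i\<le>N. fps_of_poly (B i) * complex_fps (fps_exp 1 oo L) ^ i)"
    unfolding G_def[abs_def] by (intro fps_expansion_intros f poly)
  also have "\<dots> = complex_fps (\<Sum>i\<le>N. fps_of_poly (b i) * (fps_exp 1 oo L) ^ i)"
    by (simp add: complex_fps_sum complex_fps_mult complex_fps_power complex_fps_of_poly B_def)
  also have "\<dots> = 0"
    unfolding zero by (rule fps_ext) simp
  finally have G: "G has_fps_expansion 0" .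
  have "ball 0 R \<subseteq> eball 0 (fps_conv_radius (complex_fps L))"
    using conv by (intro ball_eball_mono) auto
  hence "G holomorphic_on ball 0 R"
    unfolding G_def[abs_def] f_def by (intro holomorphic_intros) auto
  \<comment> \<open>The identity theorem spreads the zero expansion at the origin over the
    disc.\<close>
  hence G_eq_0: "G z = 0" if "norm z < R" for z
    using that G conv(2) by (intro has_fps_expansion_0_analytic_continuation[of G "ball 0 R"]) auto
  have "poly (B 0) w = 0" if w: "w \<in> S" for w
  proof -
    from path[OF w] obtain \<gamma> where \<gamma>: "(\<gamma> \<longlongrightarrow> w) (at_left (1::real))"
      "eventually (\<lambda>r. norm (\<gamma> r) < R) (at_left 1)"
      "filterlim (\<lambda>r. Re (eval_fps (complex_fps L) (\<gamma> r))) at_bot (at_left 1)"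
      by blast
    have "((\<lambda>r. norm (f (\<gamma> r))) \<longlongrightarrow> 0) (at_left 1)"
      unfolding f_def norm_exp_eq_Re by (rule filterlim_compose[OF exp_at_bot \<gamma>(3)])
    hence f0: "((\<lambda>r. f (\<gamma> r)) \<longlongrightarrow> 0) (at_left 1)"
      by (simp add: tendsto_norm_zero_iff)
    have "((\<lambda>r. G (\<gamma> r)) \<longlongrightarrow> (\<Sum>i\<le>N. poly (B i) w * 0 ^ i)) (at_left 1)"
      unfolding G_def by (intro tendsto_intros \<gamma> f0)
    \<comment> \<open>As 0^0 = 1, exactly the term i = 0 survives.\<close>
    also have "(\<Sum>i\<le>N. poly (B i) w * 0 ^ i) = (\<Sum>i\<in>{0}. poly (B i) w * 0 ^ i)"
      by (intro sum.mono_neutral_right) auto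
    finally have "((\<lambda>r. G (\<gamma> r)) \<longlongrightarrow> poly (B 0) w) (at_left 1)" by simp
    moreover have "((\<lambda>r. G (\<gamma> r)) \<longlongrightarrow> 0) (at_left 1)"
      using \<gamma>(2) by (intro tendsto_eventually) (auto elim!: eventually_mono intro: G_eq_0)
    ultimately show ?thesis
      using tendsto_unique trivial_limit_at_left_real by blast
  qed
  hence "S \<subseteq> {z. poly (B 0) z = 0}" by auto
  moreover have "B 0 \<noteq> 0"
    using b0 unfolding B_def by (subst map_poly_eq_0_iff) auto
  ultimately show False
    using S poly_roots_finite finite_subset by blast
qed

section \<open>Logarithmic series weighted by the p-adic valuation\<close>

lemma sums_log_multiples:
  fixes x :: complex
  assumes "norm x < 1" "N > 0"
  shows "(\<lambda>n. if N dvd n then x ^ n / of_nat n else 0) sums (- Ln (1 - x ^ N) / of_nat N)"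
proof -
  have "norm (- (x ^ N)) < 1"
    using assms by (simp add: norm_power power_less_one_iff)
  from Ln_series'[OF this] have "(\<lambda>n. - ((x ^ N) ^ n / of_nat n)) sums Ln (1 - x ^ N)"
    by simp
  \<comment> \<open>The logarithm series in x^N, divided by N, is the subseries over the multiples
    of \<open>N\<close>. Its term at n = 0 is 0 by the convention for division by zero.\<close>
  from sums_divide[OF sums_minus[OF this], of "of_nat N"]
  have "(\<lambda>n. x ^ (N * n) / of_nat (N * n)) sums (- Ln (1 - x ^ N) / of_nat N)"
    by (simp add: power_mult[of x N] mult.commute[where 'a = complex])
  also have "(\<lambda>n. x ^ (N * n) / of_nat (N * n)) =
      (\<lambda>n. (\<lambda>n. if N dvd n then x ^ n / of_nat n else 0) (N * n))"
    by simp
  finally show ?thesis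
    using assms(2)
    by (subst (asm) sums_mono_reindex) (auto simp: strict_mono_def elim!: dvdE)
qed

text \<open>
  A coefficient depending only on the $p$-adic valuation of $n$ is a telescoping sum over the powers of
  $p$ dividing $n$.  Up to $p^{j-1}$ this yields logarithms regular at the root of unity of order $p^j$;
  the remaining terms, with $p^j \mid n$, are real there and only have to be estimated.
\<close>

lemma multiplicity_weight_le:
  fixes W :: "nat \<Rightarrow> real" and p e n j :: nat
  assumes "prime p" "\<not> p dvd e" "n > 0"
    and W: "W 0 = 1" "\<And>k. W (Suc k) < W k"
  shows "(if e dvd n then W (Suc (multiplicity p n)) else 1) \<le>
      1 - (\<Sum>k<j. (W k - W (Suc k)) * of_bool (e * p ^ k dvd n))
        - (W j - W (Suc j)) * of_bool (e * p ^ j dvd n)"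
    and "\<not> e * p ^ j dvd n \<Longrightarrow> (if e dvd n then W (Suc (multiplicity p n)) else 1) =
      1 - (\<Sum>k<j. (W k - W (Suc k)) * of_bool (e * p ^ k dvd n))"
proof -
  define v where "v = multiplicity p n"
  have dvd_iff: "e * p ^ k dvd n \<longleftrightarrow> e dvd n \<and> k \<le> v" for k
  proof -
    have "coprime e (p ^ k)"
      using assms(1,2) by (metis coprime_commute coprime_power_right_iff prime_imp_coprime)
    hence "e * p ^ k dvd n \<longleftrightarrow> e dvd n \<and> p ^ k dvd n"
      by (metis divides_mult dvd_mult_left dvd_mult_right)
    also have "p ^ k dvd n \<longleftrightarrow> k \<le> v"
      unfolding v_def using assms(1,3)
      by (intro power_dvd_iff_le_multiplicity) (auto simp: not_prime_unit)
    finally show ?thesis .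
  qed
  have telescope: "(\<Sum>k<i. W k - W (Suc k)) = 1 - W i" for i
    using sum_lessThan_telescope'[of W i] W(1) by simp
  \<comment> \<open>The powers of \<open>p\<close> dividing \<open>n\<close> end at exponent
    \<open>v\<close>, so the telescoping sum stops at the smaller of \<open>j\<close> and
    \<open>Suc v\<close>.\<close>
  have sum_eq: "(\<Sum>k<j. (W k - W (Suc k)) * of_bool (e * p ^ k dvd n)) = 1 - W (min j (Suc v))"
    if "e dvd n"
  proof -
    have "(\<Sum>k<j. (W k - W (Suc k)) * of_bool (e * p ^ k dvd n)) =
        (\<Sum>k<min j (Suc v). W k - W (Suc k))"
      using that by (intro sum.mono_neutral_cong_right) (auto simp: dvd_iff)
    thus ?thesis by (simp only: telescope)
  qed
  have W_mono: "W i \<le> W k" if "k \<le> i" for i k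
    using lift_Suc_antimono_le[of W, OF less_imp_le[OF W(2)] that] .
  show "(if e dvd n then W (Suc (multiplicity p n)) else 1) \<le>
      1 - (\<Sum>k<j. (W k - W (Suc k)) * of_bool (e * p ^ k dvd n))
        - (W j - W (Suc j)) * of_bool (e * p ^ j dvd n)"
  proof (cases "e dvd n")
    \<comment> \<open>If j <= v, the right side collapses to \<open>W (Suc j)\<close>, which is at
      least \<open>W (Suc v)\<close>; if j > v, both sides agree.\<close>
    case True
    show ?thesis
      using True W_mono[of "Suc j" "Suc v"] W_mono[of j "Suc v"] unfolding sum_eq[OF True] v_def[symmetric]
      by (auto simp: dvd_iff min_def)
  qed (simp add: dvd_iff)
  show "(if e dvd n then W (Suc (multiplicity p n)) else 1) =
      1 - (\<Sum>k<j. (W k - W (Suc k)) * of_bool (e * p ^ k dvd n))" if "\<not> e * p ^ j dvd n"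
  proof (cases "e dvd n")
    case True
    show ?thesis
      using True that unfolding sum_eq[OF True] v_def[symmetric]
      by (auto simp: dvd_iff min_def le_Suc_eq)
  qed (simp add: dvd_iff)
qed

text \<open>The comparison is made term by term. Where e * p^j does not divide n, the weight equals
  its truncated telescoping sum; where it does, the power of \<omega> is 1, the term is a
  nonnegative real, and the inequality of weights may be multiplied by it. Both bounding series are
  sums of logarithms.\<close>

lemma Re_weighted_log_series_le:
  fixes W :: "nat \<Rightarrow> real" and p e j :: nat and \<omega> T :: complex and r :: real
  assumes p: "prime p" and e: "\<not> p dvd e"
    and W: "W 0 = 1" "\<And>k. W (Suc k) < W k"
    and r: "0 < r" "r < 1" and \<omega>: "\<omega> ^ (p ^ j) = 1"
    and T: "(\<lambda>n. of_real (if e dvd n then W (Suc (multiplicity p n)) else 1) *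
              ((of_real r * \<omega>) ^ n / of_nat n)) sums T"
  shows "Re T \<le> - ln (norm (1 - of_real r * \<omega>))
    + (\<Sum>k<j. (W k - W (Suc k)) / (e * p ^ k) * ln (norm (1 - (of_real r * \<omega>) ^ (e * p ^ k))))
    + (W j - W (Suc j)) / (e * p ^ j) * ln (1 - r ^ (e * p ^ j))"
proof -
  define x where "x = of_real r * \<omega>"
  define D where "D k = W k - W (Suc k)" for k
  define \<beta> where "\<beta> n = (if e dvd n then W (Suc (multiplicity p n)) else 1)" for n
  \<comment> \<open>Real part of the logarithm series over the multiples of \<open>N\<close>; every
    series below is a combination of these.\<close>
  define g where "g N n = Re (if N dvd n then x ^ n / of_nat n else 0)" for N n :: nat
  have e_pos: "e > 0" using e by (cases e) auto
  have p_pos: "p > 0" using p by (rule prime_gt_0_nat)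
  have "norm (\<omega> ^ (p ^ j)) = 1" by (simp only: \<omega> norm_one)
  hence "norm \<omega> = 1"
    using p_pos power_eq_iff_eq_base[of "p ^ j" "norm \<omega>" 1] by (simp add: norm_power)
  hence norm_x: "norm x = r" using r by (simp add: x_def norm_mult)
  have g_sums: "g N sums (- ln (norm (1 - x ^ N)) / N)" if "N > 0" for N
  proof -
    have "norm (x ^ N) < 1"
      using that r norm_x by (simp add: norm_power power_less_one_iff)
    hence "1 - x ^ N \<noteq> 0" by auto
    thus ?thesis
      using sums_Re[OF sums_log_multiples[of x N]] that norm_x r(2) unfolding g_def[abs_def]
      by (simp add: Re_divide_of_nat)
  qed
  have x_pow: "x ^ n = of_real (r ^ n)" if "p ^ j dvd n" for n
    using that by (auto simp: x_def power_mult_distrib power_mult \<omega> elim!: dvdE)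
  have lhs_sums: "(\<lambda>n. \<beta> n * g 1 n) sums Re T"
    using sums_Re[OF T] by (simp add: \<beta>_def g_def[abs_def] x_def)
  have rhs_sums: "(\<lambda>n. g 1 n - (\<Sum>k<j. D k * g (e * p ^ k) n) - D j * g (e * p ^ j) n) sums
     (- ln (norm (1 - x ^ 1)) / real 1
      - (\<Sum>k<j. D k * (- ln (norm (1 - x ^ (e * p ^ k))) / real (e * p ^ k)))
      - D j * (- ln (norm (1 - x ^ (e * p ^ j))) / real (e * p ^ j)))"
    using e_pos p_pos by (intro sums_diff sums_sum sums_mult g_sums) auto
  have le: "\<beta> n * g 1 n \<le>
      g 1 n - (\<Sum>k<j. D k * g (e * p ^ k) n) - D j * g (e * p ^ j) n" for n
  proof (cases "n = 0")
    case True
    thus ?thesis by (simp add: g_def)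
  next
    case False
    have g: "g N n = of_bool (N dvd n) * g 1 n" for N
      by (simp add: g_def)
    have rhs: "g 1 n - (\<Sum>k<j. D k * g (e * p ^ k) n) - D j * g (e * p ^ j) n =
      (1 - (\<Sum>k<j. D k * of_bool (e * p ^ k dvd n)) - D j * of_bool (e * p ^ j dvd n)) * g 1 n"
      unfolding g[of "e * p ^ _"] by (simp only: left_diff_distrib sum_distrib_right mult_1 mult.assoc)
    note weight = multiplicity_weight_le[where W = W and p = p and e = e and n = n and j = j,
        OF p e _ W, folded D_def \<beta>_def]
    show ?thesis
    proof (cases "e * p ^ j dvd n")
      case True
      hence "x ^ n = of_real (r ^ n)" by (intro x_pow) (rule dvd_mult_right)
      hence "g 1 n = Re (of_real (r ^ n / n))" by (simp add: g_def)
      hence "g 1 n = r ^ n / n" by (simp only: Re_complex_of_real)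
      hence "g 1 n \<ge> 0" using r by simp
      thus ?thesis
        unfolding rhs using weight(1) False by (intro mult_right_mono) auto
    next
      case notdvd: False
      thus ?thesis
        unfolding rhs using weight(2) False by simp
    qed
  qed
  have "Re T \<le> - ln (norm (1 - x ^ 1)) / real 1
      - (\<Sum>k<j. D k * (- ln (norm (1 - x ^ (e * p ^ k))) / real (e * p ^ k)))
      - D j * (- ln (norm (1 - x ^ (e * p ^ j))) / real (e * p ^ j))"
    by (rule sums_le[OF le lhs_sums rhs_sums])
  moreover have "norm (1 - x ^ (e * p ^ j)) = 1 - r ^ (e * p ^ j)"
  proof -
    have "1 - x ^ (e * p ^ j) = of_real (1 - r ^ (e * p ^ j))"
      by (subst x_pow) auto
    moreover have "r ^ (e * p ^ j) \<le> 1" using r by (intro power_le_one) auto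
    ultimately show ?thesis by (simp only: norm_of_real)
  qed
  ultimately show ?thesis
    by (simp add: x_def D_def sum_negf)
qed

text \<open>Only the last logarithm is singular at r = 1. Its coefficient is positive, so it drives
  the whole bound to minus infinity.\<close>

lemma log_bound_at_bot:
  fixes W :: "nat \<Rightarrow> real" and p e j :: nat and \<omega> :: complex
  assumes p: "prime p" and e: "\<not> p dvd e" and W: "W (Suc j) < W j"
    and \<omega>: "\<And>k. \<omega> ^ k = 1 \<longleftrightarrow> p ^ j dvd k" and j: "j > 0"
  shows "filterlim (\<lambda>r. - ln (norm (1 - of_real r * \<omega>))
    + (\<Sum>k<j. (W k - W (Suc k)) / (e * p ^ k) * ln (norm (1 - (of_real r * \<omega>) ^ (e * p ^ k))))
    + (W j - W (Suc j)) / (e * p ^ j) * ln (1 - r ^ (e * p ^ j))) at_bot (at_left 1)"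
proof -
  have e_pos: "e > 0" using e by (cases e) auto
  have p_gt_1: "p > 1" using p by (rule prime_gt_1_nat)
  have id: "((\<lambda>r. r) \<longlongrightarrow> 1) (at_left (1::real))" by simp
  have "\<omega> \<noteq> 1" using \<omega>[of 1] j p_gt_1 by auto
  \<comment> \<open>Since \<open>e\<close> is prime to \<open>p\<close>, p^j cannot divide e * p^k;
    hence these logarithms stay finite at r = 1.\<close>
  moreover have "\<omega> ^ (e * p ^ k) \<noteq> 1" if "k < j" for k
  proof
    assume "\<omega> ^ (e * p ^ k) = 1"
    hence "p ^ j dvd e * p ^ k" by (simp only: \<omega>)
    moreover have "coprime (p ^ j) e"
      using p e by (simp add: prime_imp_coprime)
    ultimately have "p ^ j dvd p ^ k"
      by (simp add: coprime_dvd_mult_right_iff)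
    thus False using that p_gt_1 by (simp add: power_dvd_imp_le dvd_power_iff_le)
  qed
  ultimately have lim: "((\<lambda>r. - ln (norm (1 - of_real r * \<omega>))
      + (\<Sum>k<j. (W k - W (Suc k)) / (e * p ^ k) * ln (norm (1 - (of_real r * \<omega>) ^ (e * p ^ k)))))
    \<longlongrightarrow> - ln (norm (1 - of_real 1 * \<omega>))
      + (\<Sum>k<j. (W k - W (Suc k)) / (e * p ^ k) * ln (norm (1 - (of_real 1 * \<omega>) ^ (e * p ^ k)))))
    (at_left 1)"
    by (intro tendsto_intros id) auto
  have "filterlim (\<lambda>r::real. 1 - r ^ (e * p ^ j)) (at_right 0) (at_left 1)"
  proof -
    have "((\<lambda>r::real. 1 - r ^ (e * p ^ j)) \<longlongrightarrow> 1 - 1 ^ (e * p ^ j)) (at_left 1)"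
      by (intro tendsto_intros id)
    moreover have "eventually (\<lambda>r::real. r \<in> {0<..<1}) (at_left 1)"
      by (rule eventually_at_left_real) simp
    hence "eventually (\<lambda>r::real. 1 - r ^ (e * p ^ j) > 0) (at_left 1)"
      using e_pos p_gt_1 by (auto elim!: eventually_mono simp: power_less_one_iff)
    ultimately show ?thesis
      by (simp add: filterlim_at eventually_conj_iff eventually_mono)
  qed
  hence "filterlim (\<lambda>r::real. ln (1 - r ^ (e * p ^ j))) at_bot (at_left 1)"
    by (rule filterlim_compose[OF ln_at_0])
  hence "filterlim (\<lambda>r::real. (W j - W (Suc j)) / (e * p ^ j) * ln (1 - r ^ (e * p ^ j))) at_bot (at_left 1)"
    using W e_pos p_gt_1 by (intro filterlim_tendsto_pos_mult_at_bot[OF tendsto_const]) auto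
  thus ?thesis
    by (simp only: filterlim_tendsto_add_at_bot_iff[OF lim])
qed

lemma primitive_root_of_unity:
  assumes "N > 0"
  shows "exp (2 * of_real pi * \<i> / of_nat N) ^ k = 1 \<longleftrightarrow> N dvd k"
proof -
  have "exp (2 * of_real pi * \<i> / of_nat N) ^ k = exp (2 * of_real pi * \<i> * of_nat k / of_nat N)"
    by (simp add: mult_ac flip: exp_of_nat_mult)
  thus ?thesis
    using complex_root_unity_eq_1[of N k] assms by simp
qed

subsection \<open>The map $x^q + ax$\<close>

text \<open>\<open>a_power\<close> places \<open>a\<close> in the field with q elements, so that
  multiplication by \<open>a\<close> commutes with x -> x^q; \<open>poly_root\<close> is the form in
  which algebraic closedness enters.\<close>

locale frobenius_power =
  fixes p m :: nat and a :: "'k::field"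
  assumes prime_p: "prime p" and m_pos: "m > 0" and char_p: "CHAR('k) = p"
    and poly_root: "\<And>g :: 'k poly. degree g > 0 \<Longrightarrow> \<exists>x. poly g x = 0"
    and a_nonzero: "a \<noteq> 0" and a_power: "a ^ (p ^ m) = a"
begin

section \<open>Counting fixed points of the iterates\<close>

abbreviation q :: nat where "q \<equiv> p ^ m"

lemma p_ge_2: "p \<ge> 2"
  using prime_p by (rule prime_ge_2_nat)

lemma p_pos [simp]: "p > 0" "p \<noteq> 0"
  using prime_gt_0_nat[OF prime_p] by simp_all

lemma q_ge_2: "q \<ge> 2"
  using p_ge_2 m_pos by (metis le_trans self_le_power one_le_numeral order.trans)

lemma q_power_pos: "q ^ i > 0"
  using p_ge_2 by simp

lemma add_power_q: "(x + y :: 'k) ^ (q ^ i) = x ^ (q ^ i) + y ^ (q ^ i)"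
  by (rule freshmans_dream'[of _ "m * i"]) (auto simp: char_p prime_p power_mult)

text \<open>The map is additive with trivial kernel, hence injective; it is surjective because
  x^(q^i) - y has a root.\<close>

lemma bij_power_q: "bij (\<lambda>x::'k. x ^ (q ^ i))"
proof (rule bijI)
  show "inj (\<lambda>x::'k. x ^ (q ^ i))"
  proof (rule injI)
    fix x y :: 'k assume "x ^ (q ^ i) = y ^ (q ^ i)"
    with add_power_q[of "x - y" y i] have "(x - y) ^ (q ^ i) = 0" by simp
    thus "x = y" by simp
  qed
  show "surj (\<lambda>x::'k. x ^ (q ^ i))"
  proof -
    have "\<exists>x. y = x ^ (q ^ i)" for y :: 'k
    proof -
      have "degree (monom 1 (q ^ i) - [:y:]) = q ^ i"
        using q_power_pos[of i] by (simp add: degree_add_eq_left degree_monom_eq flip: add_uminus_conv_diff)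
      hence "degree (monom 1 (q ^ i) - [:y:]) > 0"
        by (simp only: q_power_pos)
      from poly_root[OF this] show ?thesis
        by (auto simp: poly_monom)
    qed
    thus ?thesis by (simp add: surj_def)
  qed
qed

text \<open>Factor g = T^s u with u(0) nonzero. The operator of T^s is bijective, so the kernel has
  the same size as that of u, whose linearized polynomial is separable of degree q^(deg u).\<close>

lemma card_roots_linearized:
  fixes g :: "'k poly"
  assumes "g \<noteq> 0"
  shows "card {x. poly (linearized q g) x = 0} = q ^ (degree g - order 0 g)"
proof -
  define s where "s = order 0 g"
  from order_decomp[OF assms, of 0] obtain u
    where g: "g = [:0, 1:] ^ s * u" and u: "\<not> [:0, 1:] dvd u"
    by (auto simp: s_def)
  from u have u0: "coeff u 0 \<noteq> 0" "u \<noteq> 0"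
    by (auto simp: poly_eq_0_iff_dvd[of u 0, simplified, symmetric] poly_0_coeff_0)
  have deg: "degree g = s + degree u"
    unfolding g using u0 by (subst degree_mult_eq) (auto simp: degree_power_eq)
  have "{x. poly (linearized q g) x = 0} = (\<lambda>x. x ^ (q ^ s)) -` {x. poly (linearized q u) x = 0}"
    by (auto simp: g poly_linearized_shift)
  hence "card {x. poly (linearized q g) x = 0} = card {x. poly (linearized q u) x = 0}"
    using bij_power_q[of s] by (metis bij_betw_def bij_def card_vimage_inj subset_UNIV)
  also have "\<dots> = degree (linearized q u)"
  proof (rule card_roots_eq_degree)
    show "linearized q u \<noteq> 0"
    proof
      assume "linearized q u = 0"
      with degree_linearized[OF u0(2) q_ge_2] have "q ^ degree u = 0" by simp
      thus False using q_power_pos[of "degree u"] by simp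
    qed
    have "of_nat q = (0 :: 'k)"
      using m_pos by (simp add: of_nat_eq_0_iff_char_dvd char_p)
    thus "poly (pderiv (linearized q u)) x \<noteq> 0" for x
      using u0 by (simp add: pderiv_linearized)
  qed (rule poly_root)
  also have "\<dots> = q ^ degree u"
    by (rule degree_linearized[OF u0(2) q_ge_2])
  finally show ?thesis using deg by (simp add: s_def)
qed

text \<open>The map is the operator of T + a. As \<open>a\<close> commutes with x -> x^q, composing
  operators is multiplying polynomials.\<close>

lemma funpow_eq_linearized:
  "(poly (monom 1 q + monom a 1) ^^ n) x = poly (linearized q ([:a, 1:] ^ n)) x"
proof (induction n arbitrary: x)
  case 0
  show ?case using poly_linearized_const[of q 1 x] by (simp add: one_pCons)
next
  case (Suc n)
  define h where "h = [:a, 1:] ^ n"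
  have a_pow: "a ^ (q ^ i) = a" for i
    by (induction i) (simp_all add: power_mult a_power)
  have "(poly (monom 1 q + monom a 1) ^^ Suc n) x = poly (linearized q h) (x ^ q + a * x)"
    by (simp only: funpow_Suc_right comp_def Suc.IH h_def poly_add poly_monom power_one_right mult_1)
  also have "\<dots> = poly (linearized q h) (x ^ q) + a * poly (linearized q h) x"
    by (simp add: poly_linearized[OF order.refl] add_power_q power_mult_distrib a_pow
        algebra_simps sum.distrib sum_distrib_left)
  also have "\<dots> = poly (linearized q ([:a, 1:] * h)) x"
    by (simp add: poly_linearized_add poly_linearized_smult poly_linearized_pCons_0)
  finally show ?case by (simp only: h_def power_Suc)
qed

text \<open>With n = n' p^k and n' prime to p, the polynomial is the p^k-th power of (T + a)^n' - 1,
  and that one has a simple zero at 0.\<close>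

lemma order_shifted_power_minus_1:
  assumes "n > 0" "a ^ n = 1"
  shows "order 0 ([:a, 1:] ^ n - 1) = p ^ multiplicity p n"
proof -
  define k where "k = multiplicity p n"
  obtain n' where n: "n = n' * p ^ k" "\<not> p dvd n'"
    using multiplicity_decompose'[of n p] assms prime_p
    by (metis k_def mult.commute not_prime_unit not_gr_zero)
  have n'0: "n' > 0" using n by (cases n') auto
  define v where "v = [:a, 1:] ^ n' - 1"
  have "CHAR('k poly) = p" by (simp add: char_p)
  hence fd: "(x + y) ^ (p ^ k) = x ^ (p ^ k) + y ^ (p ^ k)" for x y :: "'k poly"
    by (intro freshmans_dream'[of _ k]) (auto simp: prime_p)
  \<comment> \<open>The p^k-th power of a^n' - 1 is a^n - 1 = 0, so a^n' = 1 already.\<close>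
  have "(a ^ n' - 1 + 1) ^ (p ^ k) = (a ^ n' - 1) ^ (p ^ k) + 1 ^ (p ^ k)"
    by (intro freshmans_dream'[of _ k]) (auto simp: prime_p char_p)
  hence an': "a ^ n' = 1"
    using assms(2) n by (simp add: power_mult)
  have v_pow: "[:a, 1:] ^ n - 1 = v ^ (p ^ k)"
    using fd[of v 1] by (simp add: v_def n power_mult algebra_simps)
  have "poly v 0 = 0" by (simp add: v_def an')
  then obtain u where u: "v = [:0, 1:] * u"
    by (metis poly_eq_0_iff_dvd dvdE minus_zero)
  \<comment> \<open>The derivative at 0 is nonzero because p does not divide n'; this is the
    simplicity of the zero.\<close>
  have "poly (pderiv v) 0 = of_nat n' * a ^ (n' - 1)"
    by (simp add: v_def pderiv_diff pderiv_power pderiv_pCons mult.commute)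
  moreover have "poly (pderiv v) 0 = poly u 0"
    unfolding u by (simp add: pderiv_mult pderiv_pCons)
  ultimately have u0: "poly u 0 \<noteq> 0"
    using n a_nonzero by (simp add: of_nat_eq_0_iff_char_dvd char_p)
  have "order 0 (v ^ (p ^ k)) = order 0 ([:- 0, 1:] ^ (p ^ k) * u ^ (p ^ k))"
    by (simp only: u power_mult_distrib minus_zero)
  also have "\<dots> = p ^ k"
  proof (subst order_mult)
    show "order 0 ([:- 0, 1:] ^ (p ^ k)) + order 0 (u ^ (p ^ k)) = p ^ k"
      using u0 by (simp only: order_power_n_n) (simp add: order_0I)
    show "[:- 0, 1:] ^ (p ^ k) * u ^ (p ^ k) \<noteq> 0"
      using u0 by auto
  qed
  finally show ?thesis
    by (simp add: v_pow k_def)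
qed

text \<open>Fixed points form the kernel of the operator of (T + a)^n - 1, of degree n. Its value at
  0 is a^n - 1, so its order there is 0 unless a^n = 1.\<close>

lemma num_fixpoints_eq:
  assumes "n > 0"
  shows "num_fixpoints (monom 1 q + monom a 1) n =
    (if a ^ n = 1 then q ^ (n - p ^ multiplicity p n) else q ^ n)"
proof -
  define g where "g = [:a, 1:] ^ n - 1"
  have deg: "degree g = n"
    unfolding g_def using assms
    by (simp add: degree_add_eq_left degree_power_eq flip: add_uminus_conv_diff)
  hence g0: "g \<noteq> 0" using assms by auto
  have "poly (linearized q g) x = poly (linearized q ([:a, 1:] ^ n)) x - x" for x
    unfolding g_def using poly_linearized_const[of q 1 x]
    by (simp add: poly_linearized_diff one_pCons)
  hence "num_fixpoints (monom 1 q + monom a 1) n = card {x. poly (linearized q g) x = 0}"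
    by (simp only: num_fixpoints_def funpow_eq_linearized right_minus_eq)
  also have "\<dots> = q ^ (n - order 0 g)"
    by (simp add: card_roots_linearized[OF g0] deg)
  finally show ?thesis
    using order_shifted_power_minus_1[OF assms] order_0I[of g 0] by (auto simp: g_def)
qed

text \<open>\<open>e\<close> is the multiplicative order of \<open>a\<close>. It divides q - 1, and
  p divides q, so p cannot divide \<open>e\<close>.\<close>

lemma order_of_a:
  assumes "a ^ (q - 1) = 1"
  obtains e where "e > 0" "\<not> p dvd e" "\<And>n. a ^ n = 1 \<longleftrightarrow> e dvd n"
proof -
  define e where "e = (LEAST n. n > 0 \<and> a ^ n = 1)"
  have ex: "q - 1 > 0 \<and> a ^ (q - 1) = 1" using assms q_ge_2 by auto
  have e: "e > 0" "a ^ e = 1"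
    using LeastI[of "\<lambda>n. n > 0 \<and> a ^ n = 1", OF ex] by (auto simp: e_def)
  have min: "e \<le> n" if "n > 0" "a ^ n = 1" for n
    unfolding e_def using that by (intro Least_le) auto
  have dvd: "a ^ n = 1 \<longleftrightarrow> e dvd n" for n
  proof
    assume n: "a ^ n = 1"
    have "a ^ n = (a ^ e) ^ (n div e) * a ^ (n mod e)"
      by (metis power_add power_mult mult_div_mod_eq)
    hence "a ^ (n mod e) = 1" using n e by simp
    hence "n mod e = 0"
      using min[of "n mod e"] e by (metis mod_less_divisor not_le gr0I)
    thus "e dvd n" by auto
  qed (auto simp: e power_mult elim!: dvdE)
  have "\<not> p dvd e"
  proof
    assume "p dvd e"
    also have "e dvd q - 1" using dvd assms by blast
    finally have "p dvd q - 1" .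
    moreover have "p dvd q" using m_pos by auto
    ultimately have "p dvd q - (q - 1)" by (rule dvd_diff_nat[rotated])
    thus False using q_ge_2 p_ge_2 by auto
  qed
  with e dvd that show ?thesis by blast
qed

section \<open>Singular behaviour of the logarithm of the zeta function\<close>

abbreviation f :: "'k poly" where "f \<equiv> monom 1 q + monom a 1"

text \<open>
  The shift by one makes room for the value $1$ of $a_n/q^n$ when $a^n \neq 1$.
\<close>

definition weight :: "nat \<Rightarrow> real" where
  "weight k = (case k of 0 \<Rightarrow> 1 | Suc i \<Rightarrow> (1 / q) ^ (p ^ i))"

lemma weight_strict_antimono: "weight (Suc k) < weight k"
proof -
  have q: "0 < 1 / real q" "1 / real q < 1"
    using q_ge_2 by (simp, subst divide_less_eq_1_pos) linarith+
  show ?thesis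
  proof (cases k)
    case 0
    thus ?thesis using q(2) by (simp add: weight_def)
  next
    case (Suc i)
    have "p ^ i < p ^ Suc i" using p_ge_2 by simp
    thus ?thesis
      unfolding weight_def Suc nat.case by (rule power_strict_decreasing) (fact q)+
  qed
qed

lemma num_fixpoints_le: "n > 0 \<Longrightarrow> num_fixpoints f n \<le> q ^ n"
  using q_ge_2 by (simp only: num_fixpoints_eq split: if_splits) (auto intro!: power_increasing)

lemma num_fixpoints_div:
  assumes "n > 0"
  shows "real (num_fixpoints f n) / real q ^ n =
    (if a ^ n = 1 then weight (Suc (multiplicity p n)) else 1)"
proof -
  \<comment> \<open>Ensures that the natural subtraction in the exponent n - p^v is not
    truncated.\<close>
  have "p ^ multiplicity p n \<le> n"
    using assms by (intro dvd_imp_le multiplicity_dvd)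
  hence "real q ^ n = real q ^ (n - p ^ multiplicity p n) * real q ^ (p ^ multiplicity p n)"
    by (simp flip: power_add)
  moreover have "real q > 0" using q_ge_2 by linarith
  ultimately show ?thesis
    unfolding num_fixpoints_eq[OF assms] weight_def by (simp add: power_divide)
qed

text \<open>The criterion for exponentials of power series is applied with radius 1/q, the points
  \<omega>/q for \<omega> of order p^j with j >= 1, and radial paths.\<close>

lemma zeta_no_relation:
  assumes ae: "a ^ (q - 1) = 1" and b0: "b 0 \<noteq> 0"
  shows "(\<Sum>i\<le>N. fps_of_poly (b i) * artin_mazur_zeta f ^ i) \<noteq> 0"
proof -
  define L where "L = Abs_fps (\<lambda>n. if n = 0 then 0 else of_nat (num_fixpoints f n) / of_nat n :: rat)"
  define \<omega> where "\<omega> j = exp (2 * of_real pi * \<i> / of_nat (p ^ j))" for j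
  obtain e where e: "e > 0" "\<not> p dvd e" "\<And>n. a ^ n = 1 \<longleftrightarrow> e dvd n"
    using order_of_a[OF ae] by blast
  have q_pos: "real q > 0" using q_ge_2 by linarith
  have \<omega>: "\<omega> j ^ k = 1 \<longleftrightarrow> p ^ j dvd k" for j k
    unfolding \<omega>_def using p_ge_2 by (intro primitive_root_of_unity) auto
  have norm_\<omega>: "norm (\<omega> j) = 1" for j
    by (simp add: \<omega>_def)
  have nth: "fps_nth (complex_fps L) n = of_real (real (num_fixpoints f n) / real n)" for n
    by (simp add: L_def of_rat_divide)
  have conv: "fps_conv_radius (complex_fps L) \<ge> ereal (1 / q)"
    unfolding fps_conv_radius_def
  proof (rule conv_radius_geI_ex)
    fix r :: real assume r: "0 < r" "ereal r < ereal (1 / q)"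
    hence rq: "q * r < 1" using q_pos by (simp add: field_simps)
    have "summable (\<lambda>n. fps_nth (complex_fps L) n * of_real r ^ n)"
    proof (rule summable_comparison_test')
      show "summable (\<lambda>n. (q * r) ^ n)"
        using rq r q_pos by (intro summable_geometric) auto
      fix n :: nat assume n: "n \<ge> 1"
      have "real (num_fixpoints f n) / real n \<le> real (num_fixpoints f n) / 1"
        using n by (intro divide_left_mono) auto
      also have "\<dots> \<le> real (q ^ n)"
        unfolding div_by_1 of_nat_le_iff using n by (intro num_fixpoints_le) auto
      finally have "real (num_fixpoints f n) / real n \<le> real q ^ n" by simp
      hence "real (num_fixpoints f n) / real n * r ^ n \<le> real q ^ n * r ^ n"
        using r by (intro mult_right_mono) auto
      moreover have "norm (fps_nth (complex_fps L) n * of_real r ^ n) =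
          real (num_fixpoints f n) / real n * r ^ n"
        unfolding nth using r by (simp only: norm_mult norm_power norm_of_real) simp
      ultimately show "norm (fps_nth (complex_fps L) n * of_real r ^ n) \<le> (q * r) ^ n"
        by (simp add: power_mult_distrib)
    qed
    thus "\<exists>z. norm z = r \<and> summable (\<lambda>n. fps_nth (complex_fps L) n * z ^ n)"
      using r by (intro exI[of _ "of_real r"]) auto
  qed
  \<comment> \<open>The orders of these roots of unity differ. The successor leaves out \<omega> =
    1, where the logarithm of 1 - r \<omega> would itself be singular.\<close>
  have "inj (\<lambda>j. \<omega> (Suc j) / of_nat q)"
  proof (rule injI)
    fix i j assume "\<omega> (Suc i) / of_nat q = \<omega> (Suc j) / of_nat q"
    hence eq: "\<omega> (Suc i) = \<omega> (Suc j)" using q_pos by simp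
    have "p ^ Suc i dvd k \<longleftrightarrow> p ^ Suc j dvd k" for k
      unfolding \<omega>[symmetric] eq ..
    hence "p ^ Suc i = p ^ Suc j" by (meson dvd_antisym dvd_refl)
    thus "i = j" using p_ge_2 by (simp only: power_inject_exp Suc_inject)
  qed
  hence S: "infinite (range (\<lambda>j. \<omega> (Suc j) / of_nat q))"
    by (rule range_inj_infinite)
  have path: "\<exists>\<gamma>. (\<gamma> \<longlongrightarrow> w) (at_left (1::real)) \<and>
      eventually (\<lambda>r. norm (\<gamma> r) < 1 / q) (at_left 1) \<and>
      filterlim (\<lambda>r. Re (eval_fps (complex_fps L) (\<gamma> r))) at_bot (at_left 1)"
    if "w \<in> range (\<lambda>j. \<omega> (Suc j) / of_nat q)" for w
  proof -
    from that obtain i where w: "w = \<omega> (Suc i) / of_nat q" by blast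
    define j where "j = Suc i"
    define \<gamma> where "\<gamma> r = of_real r * \<omega> j / of_nat q" for r
    have norm_\<gamma>: "norm (\<gamma> r) < 1 / q" if "0 < r" "r < 1" for r
      using that q_pos by (simp add: \<gamma>_def norm_divide norm_mult norm_power norm_\<omega> divide_strict_right_mono)
    have in_01: "eventually (\<lambda>r::real. r \<in> {0<..<1}) (at_left 1)"
      by (rule eventually_at_left_real) simp
    have "(\<gamma> \<longlongrightarrow> of_real 1 * \<omega> j / of_nat q) (at_left 1)"
      unfolding \<gamma>_def using q_pos by (intro tendsto_intros) auto
    hence lim: "(\<gamma> \<longlongrightarrow> w) (at_left 1)" by (simp add: w j_def)
    have le: "Re (eval_fps (complex_fps L) (\<gamma> r)) \<le> - ln (norm (1 - of_real r * \<omega> j))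
      + (\<Sum>k<j. (weight k - weight (Suc k)) / (e * p ^ k) * ln (norm (1 - (of_real r * \<omega> j) ^ (e * p ^ k))))
      + (weight j - weight (Suc j)) / (e * p ^ j) * ln (1 - r ^ (e * p ^ j))"
      if r: "0 < r" "r < 1" for r
    proof (rule Re_weighted_log_series_le[where W = weight, OF prime_p e(2) _ weight_strict_antimono r])
      show "weight 0 = 1" by (simp add: weight_def)
      show "\<omega> j ^ p ^ j = 1" by (simp add: \<omega>)
      have "ereal (norm (\<gamma> r)) < fps_conv_radius (complex_fps L)"
        using norm_\<gamma>[OF r] conv by (meson ereal_less(1) less_ereal.simps(1) less_le_trans)
      from sums_eval_fps[OF this]
      have "(\<lambda>n. fps_nth (complex_fps L) n * \<gamma> r ^ n) sums eval_fps (complex_fps L) (\<gamma> r)" .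
      \<comment> \<open>The factor 1/q in the path supplies the denominator q^n that turns fixed
        point counts into weights. At n = 0 the left side is 0 by definition and the right side by
        division by zero.\<close>
      also have "(\<lambda>n. fps_nth (complex_fps L) n * \<gamma> r ^ n) =
        (\<lambda>n. of_real (if e dvd n then weight (Suc (multiplicity p n)) else 1) *
              ((of_real r * \<omega> j) ^ n / of_nat n))"
      proof
        fix n
        show "fps_nth (complex_fps L) n * \<gamma> r ^ n =
          of_real (if e dvd n then weight (Suc (multiplicity p n)) else 1) *
              ((of_real r * \<omega> j) ^ n / of_nat n)"
        proof (cases "n = 0")
          case False
          hence "of_real (if e dvd n then weight (Suc (multiplicity p n)) else 1) =
              (of_real (real (num_fixpoints f n) / real q ^ n) :: complex)"
            by (simp only: num_fixpoints_div e(3))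
          thus ?thesis
            by (simp only: nth \<gamma>_def) (simp add: power_divide)
        qed (simp add: L_def)
      qed
      finally show "(\<lambda>n. of_real (if e dvd n then weight (Suc (multiplicity p n)) else 1) *
              ((of_real r * \<omega> j) ^ n / of_nat n)) sums eval_fps (complex_fps L) (\<gamma> r)" .
    qed
    have "filterlim (\<lambda>r. Re (eval_fps (complex_fps L) (\<gamma> r))) at_bot (at_left 1)"
    proof (rule filterlim_at_bot_mono[OF log_bound_at_bot[where W = weight, OF prime_p e(2) weight_strict_antimono \<omega>]])
      show "j > 0" by (simp add: j_def)
      show "\<forall>\<^sub>F r in at_left 1. Re (eval_fps (complex_fps L) (\<gamma> r)) \<le> - ln (norm (1 - of_real r * \<omega> j))
      + (\<Sum>k<j. (weight k - weight (Suc k)) / (e * p ^ k) * ln (norm (1 - (of_real r * \<omega> j) ^ (e * p ^ k))))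
      + (weight j - weight (Suc j)) / (e * p ^ j) * ln (1 - r ^ (e * p ^ j))"
        using in_01 by (rule eventually_mono) (rule le, auto)
    qed
    moreover have "eventually (\<lambda>r. norm (\<gamma> r) < 1 / q) (at_left 1)"
      using in_01 by (rule eventually_mono) (rule norm_\<gamma>, auto)
    ultimately show ?thesis using lim by blast
  qed
  show ?thesis
    unfolding artin_mazur_zeta_def L_def[symmetric]
  proof (rule no_relation_exp_fps[where b = b, OF _ conv _ S path b0])
    show "fps_nth L 0 = 0" by (simp add: L_def)
    show "1 / real q > 0" using q_pos by simp
  qed
qed

end

theorem theorem2:
  fixes p m :: nat and a :: "'k::field" and Fp Fq :: "'k set"
  assumes "prime p" and "odd p" and "m > 0"
    and "algebraic_closure (ring_of_type_algebra :: 'k ring) Fp" and "card Fp = p"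
    and "subfield Fq (ring_of_type_algebra :: 'k ring)" and "card Fq = p ^ m"
    and "a \<in> Fq" and "a \<noteq> 0"
  shows "ring.transcendental (ring_of_type_algebra :: rat fls ring) rational_fls
           (fps_to_fls (artin_mazur_zeta (Polynomial.monom 1 (p ^ m) + Polynomial.monom a 1)))"
proof -
  interpret algebraic_closure "ring_of_type_algebra :: 'k ring" Fp by fact
  have "algebraically_closed (ring_of_type_algebra :: 'k ring)"
    by unfold_locales
  note root = algebraically_closed_imp_poly_root[OF this]
  note closed = subfield_of_type_closed[OF assms(6)]
  have "p ^ m > 0" using assms(1) by (simp add: prime_gt_0_nat)
  \<comment> \<open>An infinite set has \<open>card\<close> 0, so positive cardinality forces
    finiteness.\<close>
  hence "finite Fq" using assms(7) by (metis card.infinite less_numeral_extra(3))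
  have "of_nat (card Fq) = (0 :: 'k)"
    using \<open>finite Fq\<close> assms(8) closed(1,3) by (intro of_nat_card_eq_0) auto
  \<comment> \<open>The characteristic is thus a power of p; being positive it is prime, so it is p
    itself.\<close>
  hence "CHAR('k) dvd p ^ m"
    by (simp only: assms(7) of_nat_eq_0_iff_char_dvd)
  then obtain i where "CHAR('k) = p ^ i" "i \<le> m"
    using divides_primepow_nat assms(1) by blast
  moreover from this have "prime CHAR('k)"
    using assms(1) by (intro prime_CHAR_semidom) (simp add: prime_gt_0_nat)
  ultimately have char: "CHAR('k) = p"
    by (simp add: prime_power_iff)
  have a_pow: "a ^ (p ^ m - 1) = 1"
    using power_card_minus_1_eq_1[of Fq a] \<open>finite Fq\<close> closed assms(7-9) by simp
  have "a ^ (p ^ m) = a ^ (p ^ m - 1) * a"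
    using \<open>p ^ m > 0\<close> by (metis power_minus_mult)
  hence "a ^ (p ^ m) = a" by (simp only: a_pow mult_1)
  interpret frobenius_power p m a
    by unfold_locales (use assms root char \<open>a ^ (p ^ m) = a\<close> in auto)
  show ?thesis
  proof (rule transcendental_fps_to_flsI)
    have "fps_nth (artin_mazur_zeta (Polynomial.monom 1 (p ^ m) + Polynomial.monom a 1)) 0 = 1"
      by (simp add: artin_mazur_zeta_def)
    thus "artin_mazur_zeta (Polynomial.monom 1 (p ^ m) + Polynomial.monom a 1) \<noteq> 0" by auto
  qed (rule zeta_no_relation[OF a_pow])
qed

end
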